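(* Let $P\in\mathbb{R}^{(n-1)\times(n-1)}$ be symmetric positive definite, let $\xi_{\min}$ and $\xi_{\max}$ be the smallest and largest eigenvalues of the pencil $(B,P)$, and put $$\chi_{P}=\frac{8\lambda_{2}}{\lambda_{1}}\,\frac{\xi_{\max}}{\xi_{\min}}\Bigl(\frac{\lambda_{2}+\lambda_{1}}{2(\lambda_{2}-\lambda_{1})}\Bigr)^{1/2}.$$ Suppose $\rho_q=\mathrm{Rq}(q)$ satisfies $$\lambda_{1}\leq \rho_{q}\leq \lambda_{1}+\frac{\lambda_{2}-\lambda_{1}}{2+\chi_{P}}.$$ Then: 1. the region $\mathcal{Y}$ is a convex set; 2. the function $\phi$ is convex in $\mathcal{Y}$ with the $P$-inner-product $\langle x,y\rangle_P=x^{\mathsf T}Py$; 3. the problem $\min_{y\in\mathcal{Y}}\phi(y)$ has a unique solution $y_*$; 4. the eigenvector $u_1$ is given by $u_1=\psi^{\dagger}(y_* )$.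
   Context: Let $A,M\in\mathbb{R}^{n\times n}$ be symmetric positive definite. The eigenvalues of the pencil $(A,M)$ are $0<\lambda_1<\lambda_2\le\dots\le\lambda_n$, with eigenvectors $u_1,\dots,u_n$: $Au_i=\lambda_iMu_i$, $u_i^{\mathsf T}Mu_j=0$ for $i\ne j$, $\|u_i\|_M=1$, where $\|x\|_M=(x^{\mathsf T}Mx)^{1/2}$. The Rayleigh quotient is $\mathrm{Rq}(x)=\frac{x^{\mathsf T}Ax}{x^{\mathsf T}Mx}$. Let $q\in\mathbb{R}^n$ satisfy $\|q\|_M=1$, $q^{\mathsf T}Mu_1>0$, and write $\rho_q=\mathrm{Rq}(q)$. Let $Q\in\mathbb{R}^{n\times(n-1)}$ be such that $[q,Q]$ is $M$-orthogonal, i.e. $[q,Q]^{\mathsf T}M[q,Q]=I$. Define $\mathcal{S}_+^{n-1}=\{x\in\mathbb{R}^n: \|x\|_M=1,\ q^{\mathsf T}Mx>0\}$ and $\mathcal{X}=\{x\in\mathcal{S}_+^{n-1}:\mathrm{Rq}(x)\le\rho_q\}$. Define $\psi:\mathcal{S}_+^{n-1}\to\mathbb{R}^{n-1}$, $\psi(x)=\frac{Q^{\mathsf T}Mx}{q^{\mathsf T}Mx}$, and $\psi^\dagger:\mathbb{R}^{n-1}\to\mathcal{S}_+^{n-1}$, $\psi^\dagger(y)=\frac{Qy+q}{\|Qy+q\|_M}$. Let $\mathcal{Y}=\{\psi(x):x\in\mathcal{X}\}\subset\mathbb{R}^{n-1}$. Let $B=Q^{\mathsf T}AQ$, $b=Q^{\mathsf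 T}Aq$, and $$\phi(y)=\mathrm{Rq}(Qy+q)=\frac{y^{\mathsf T}By+2y^{\mathsf T}b+\rho_q}{\|y\|^2+1},\qquad y\in\mathbb{R}^{n-1},$$ where $\|\cdot\|$ is the Euclidean norm. Eigenvalues of $(B,P)$ are the numbers $\xi$ with $Bv=\xi Pv$, $v\neq0$. *)

theory Defs
  imports "HOL-Analysis.Analysis"
begin

definition sym_pos_def :: "real^'n^'n \<Rightarrow> bool" where
  "sym_pos_def A \<longleftrightarrow> transpose A = A \<and> (\<forall>x. x \<noteq> 0 \<longrightarrow> 0 < x \<bullet> (A *v x))"

definition inner_wrt :: "real^'n^'n \<Rightarrow> real^'n \<Rightarrow> real^'n \<Rightarrow> real" where
  "inner_wrt M x y = x \<bullet> (M *v y)"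

definition norm_wrt :: "real^'n^'n \<Rightarrow> real^'n \<Rightarrow> real" where
  "norm_wrt M x = sqrt (inner_wrt M x x)"

definition Rq :: "real^'n^'n \<Rightarrow> real^'n^'n \<Rightarrow> real^'n \<Rightarrow> real" where
  "Rq A M x = (x \<bullet> (A *v x)) / (x \<bullet> (M *v x))"

definition pencil_eigenvalue :: "real^'n^'n \<Rightarrow> real^'n^'n \<Rightarrow> real \<Rightarrow> bool" where
  "pencil_eigenvalue B P \<xi> \<longleftrightarrow> (\<exists>v. v \<noteq> 0 \<and> B *v v = \<xi> *\<^sub>R (P *v v))"

text \<open>Eigenvalues \<open>lam 1 < lam 2 \<le> \<dots> \<le> lam n\<close> (with multiplicity) and an \<open>M\<close>-orthonormal system of
  eigenvectors \<open>u 1, \<dots>, u n\<close>. Only the values of \<open>lam\<close> and \<open>u\<close> at \<open>1, \<dots>, n\<close> matter.\<close>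

definition pencil_eigensystem ::
    "real^'n^'n \<Rightarrow> real^'n^'n \<Rightarrow> (nat \<Rightarrow> real) \<Rightarrow> (nat \<Rightarrow> real^'n) \<Rightarrow> bool" where
  "pencil_eigensystem A M lam u \<longleftrightarrow>
     0 < lam 1 \<and> lam 1 < lam 2 \<and> mono_on {2..CARD('n)} lam \<and>
     (\<forall>i\<in>{1..CARD('n)}. A *v u i = lam i *\<^sub>R (M *v u i)) \<and>
     (\<forall>i\<in>{1..CARD('n)}. \<forall>j\<in>{1..CARD('n)}. i \<noteq> j \<longrightarrow> inner_wrt M (u i) (u j) = 0) \<and>
     (\<forall>i\<in>{1..CARD('n)}. norm_wrt M (u i) = 1)"

text \<open>The matrix \<open>[q, Q]\<close>: \<open>None\<close> indexes the column \<open>q\<close>, \<open>Some k\<close> the \<open>k\<close>-th column of \<open>Q\<close>.\<close>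

definition augment :: "real^'n \<Rightarrow> real^'m^'n \<Rightarrow> real^('m option)^'n" where
  "augment q Q = (\<chi> i j. case j of None \<Rightarrow> q $ i | Some k \<Rightarrow> Q $ i $ k)"

definition hemisphere :: "real^'n^'n \<Rightarrow> real^'n \<Rightarrow> (real^'n) set" where
  "hemisphere M q = {x. norm_wrt M x = 1 \<and> 0 < inner_wrt M q x}"

definition region_X :: "real^'n^'n \<Rightarrow> real^'n^'n \<Rightarrow> real^'n \<Rightarrow> (real^'n) set" where
  "region_X A M q = {x \<in> hemisphere M q. Rq A M x \<le> Rq A M q}"

definition psi :: "real^'n^'n \<Rightarrow> real^'n \<Rightarrow> real^'m^'n \<Rightarrow> real^'n \<Rightarrow> real^'m" where
  "psi M q Q x = (1 / inner_wrt M q x) *\<^sub>R (transpose Q *v (M *v x))"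

definition psi_dag :: "real^'n^'n \<Rightarrow> real^'n \<Rightarrow> real^'m^'n \<Rightarrow> real^'m \<Rightarrow> real^'n" where
  "psi_dag M q Q y = (1 / norm_wrt M (Q *v y + q)) *\<^sub>R (Q *v y + q)"

definition region_Y ::
    "real^'n^'n \<Rightarrow> real^'n^'n \<Rightarrow> real^'n \<Rightarrow> real^'m^'n \<Rightarrow> (real^'m) set" where
  "region_Y A M q Q = psi M q Q ` region_X A M q"

definition phi :: "real^'n^'n \<Rightarrow> real^'n^'n \<Rightarrow> real^'n \<Rightarrow> real^'m^'n \<Rightarrow> real^'m \<Rightarrow> real" where
  "phi A M q Q y = Rq A M (Q *v y + q)"

lemma phi_explicit:
  fixes A M :: "real^'n^'n" and q :: "real^'n" and Q :: "real^'m^'n"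
  assumes "transpose A = A" and "transpose M = M"
    and orth: "transpose (augment q Q) ** M ** augment q Q = mat 1"
  shows "phi A M q Q y =
    (y \<bullet> ((transpose Q ** A ** Q) *v y) + 2 * (y \<bullet> (transpose Q *v (A *v q))) + Rq A M q) /
    ((norm y)\<^sup>2 + 1)"
proof -
  have self: "(S *v v) \<bullet> w = v \<bullet> (S *v w)" if "transpose S = S" for S :: "real^'n^'n" and v w
    by (metis dot_lmul_matrix that transpose_matrix_vector)
  have tr: "y \<bullet> (transpose Q *v w) = (Q *v y) \<bullet> w" for w
    by (metis dot_lmul_matrix inner_commute transpose_matrix_vector)
  define z :: "real^('m option)" where
    "z = (\<chi> j. case j of None \<Rightarrow> 1 | Some k \<Rightarrow> y $ k)"
  define e :: "real^('m option)" where "e = (\<chi> j. case j of None \<Rightarrow> 1 | Some k \<Rightarrow> 0)"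
  have az: "augment q Q *v z = Q *v y + q" and ae: "augment q Q *v e = q"
    by (simp_all add: augment_def z_def e_def matrix_vector_mult_def vec_eq_iff UNIV_option_conv
        sum.reindex)
  have M: "(augment q Q *v v) \<bullet> (M *v (augment q Q *v v)) = v \<bullet> v" for v
  proof -
    have "(augment q Q *v v) \<bullet> (M *v (augment q Q *v v))
        = v \<bullet> ((transpose (augment q Q) ** M ** augment q Q) *v v)"
      by (metis dot_lmul_matrix inner_commute matrix_vector_mul_assoc transpose_matrix_vector)
    then show ?thesis
      by (simp add: orth)
  qed
  have den: "(Q *v y + q) \<bullet> (M *v (Q *v y + q)) = (norm y)\<^sup>2 + 1"
    using M[of z] unfolding az
    by (simp add: z_def inner_vec_def UNIV_option_conv sum.reindex power2_norm_eq_inner)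
  have "q \<bullet> (M *v q) = 1"
    using M[of e] unfolding ae by (simp add: e_def inner_vec_def UNIV_option_conv sum.reindex)
  then have rho: "Rq A M q = q \<bullet> (A *v q)"
    by (simp add: Rq_def)
  have "(Q *v y + q) \<bullet> (A *v (Q *v y + q))
      = (Q *v y) \<bullet> (A *v (Q *v y)) + 2 * ((Q *v y) \<bullet> (A *v q)) + q \<bullet> (A *v q)"
    using self[OF assms(1), of q "Q *v y"]
    by (simp add: matrix_vector_right_distrib inner_add inner_commute)
  then show ?thesis
    unfolding phi_def Rq_def[of _ _ "Q *v y + q"] den rho tr
      matrix_vector_mul_assoc[symmetric] by simp
qed

text \<open>Convexity on \<open>S\<close> with respect to the inner product \<open>\<langle>x, y\<rangle>\<^sub>P = x \<bullet> (P *v y)\<close>. The chord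
  inequality does not mention \<open>P\<close>; the inner product enters through the gradient \<open>g\<close> at \<open>x\<close>, which
  is the vector representing the derivative, \<open>f'(x) h = \<langle>g, h\<rangle>\<^sub>P\<close>, and through the first-order
  inequality \<open>f y \<ge> f x + \<langle>g, y - x\<rangle>\<^sub>P\<close>.\<close>

definition convex_on_wrt :: "real^'m^'m \<Rightarrow> (real^'m) set \<Rightarrow> (real^'m \<Rightarrow> real) \<Rightarrow> bool" where
  "convex_on_wrt P S f \<longleftrightarrow>
     convex_on S f \<and>
     (\<forall>x\<in>S. \<exists>g. (f has_derivative (\<lambda>h. inner_wrt P g h)) (at x) \<and>
                (\<forall>y\<in>S. f x + inner_wrt P g (y - x) \<le> f y))"

definition chi_P :: "real \<Rightarrow> real \<Rightarrow> real \<Rightarrow> real \<Rightarrow> real" where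
  "chi_P l1 l2 \<xi>min \<xi>max =
     8 * l2 / l1 * (\<xi>max / \<xi>min) * sqrt ((l2 + l1) / (2 * (l2 - l1)))"

end

(* In the coordinates y, phi is a quotient N(y) / (1 + |y|^2) with N quadratic, the region Y is its
   sublevel set {phi <= rho_q}, and p = psi(u_1) is its critical point with value lambda_1. Summing
   the Rayleigh quotients of the M-orthogonal vectors q and Q h gives
   h . B h >= (lambda_1 + lambda_2 - rho_q) |h|^2, so B - rho_q I is positive definite and Y is a
   solid ellipsoid; moreover
   phi(y) - lambda_1 = (y - p) . (B - lambda_1 I) (y - p) / (1 + |y|^2) confines Y to |y| <= 2/3.
   Convexity needs no Hessian: with h = z - x and g the gradient at x, the first-order inequality
   phi(z) >= phi(x) + g . h is algebraically equivalent to
   ((x + z) . h) (g . h) <= h . (B - phi(x) I) h.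
   In g . h the possibly huge B enters only through the form of C = B - phi(x) I at h and x - p, so
   Cauchy-Schwarz for C gives a bound free of lambda_n. All that is used of chi_P is chi_P >= 16. *)

theory Submission
  imports Defs
begin

section \<open>Linear algebra of symmetric and positive definite matrices\<close>

lemma symmetric_inner_matrix_vector:
  fixes S :: "real^'n^'n"
  assumes "transpose S = S"
  shows "(S *v v) \<bullet> w = v \<bullet> (S *v w)"
  by (metis assms dot_lmul_matrix transpose_matrix_vector)

lemma transpose_inner_matrix_vector:
  fixes Q :: "real^'m^'n"
  shows "y \<bullet> (transpose Q *v w) = (Q *v y) \<bullet> w"
  by (metis dot_lmul_matrix inner_commute transpose_matrix_vector)

lemma scaleR_mat_mult_vec [simp]:
  fixes x :: "real^'m"
  shows "(c *\<^sub>R mat 1) *v x = c *\<^sub>R x"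
  by (simp add: scaleR_matrix_vector_assoc[symmetric])

lemma sym_pos_def_Cauchy_Schwarz:
  fixes S :: "real^'n^'n"
  assumes "sym_pos_def S"
  shows "(x \<bullet> (S *v y))\<^sup>2 \<le> (x \<bullet> (S *v x)) * (y \<bullet> (S *v y))"
proof (cases "y = 0")
  case False
  have tr: "transpose S = S" and pos: "\<And>x. x \<noteq> 0 \<Longrightarrow> 0 < x \<bullet> (S *v x)"
    using assms by (auto simp: sym_pos_def_def)
  define c where "c = y \<bullet> (S *v y)"
  define d where "d = x \<bullet> (S *v y)"
  \<comment> \<open>Up to the factor \<open>c\<close>, \<open>v\<close> is the part of
    \<open>x\<close> orthogonal to \<open>y\<close> for the form of \<open>S\<close>; the scaling by
    \<open>c\<close> avoids a division.\<close>
  define v where "v = c *\<^sub>R x - d *\<^sub>R y"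
  have "c > 0"
    using pos False by (simp add: c_def)
  have yx: "y \<bullet> (S *v x) = d"
    using symmetric_inner_matrix_vector[OF tr, of x y] by (simp add: d_def inner_commute)
  have "0 \<le> v \<bullet> (S *v v)"
    using pos by (cases "v = 0") (auto simp: less_imp_le)
  also have "v \<bullet> (S *v v) = c * (c * (x \<bullet> (S *v x)) - d\<^sup>2)"
    using yx
    by (simp add: v_def matrix_vector_mult_diff_distrib matrix_vector_mult_scaleR inner_diff
        c_def[symmetric] d_def[symmetric] power2_eq_square algebra_simps)
  finally have "0 \<le> c * (x \<bullet> (S *v x)) - d\<^sup>2"
    using \<open>c > 0\<close> by (simp add: zero_le_mult_iff)
  then show ?thesis
    by (simp add: c_def d_def mult.commute)
qed simp

lemma sym_pos_def_pos: "sym_pos_def A \<Longrightarrow> x \<noteq> 0 \<Longrightarrow> 0 < x \<bullet> (A *v x)"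
  by (simp add: sym_pos_def_def)

text \<open>Lets a Euclidean gradient \<open>w\<close> be represented in the inner product of
  \<open>P\<close>: the representing vector \<open>g\<close> solves
  \<open>P *v g = w\<close>.\<close>

lemma sym_pos_def_surj:
  fixes P :: "real^'m^'m"
  assumes "sym_pos_def P"
  obtains g where "P *v g = w"
proof -
  have "x = 0" if "P *v x = 0" for x
    using sym_pos_def_pos[OF assms, of x] that by force
  then have "inj ((*v) P)"
    using linear_injective_0[OF matrix_vector_mul_linear, of P] by blast
  then have "surj ((*v) P)"
    using linear_injective_imp_surjective matrix_vector_mul_linear by blast
  then show thesis
    using that by (metis surjD)
qed

section \<open>Quadratic polynomials divided by \<open>(norm y)\<^sup>2 + 1\<close>\<close>

definition chart_quot :: "real^'m^'m \<Rightarrow> real^'m \<Rightarrow> real \<Rightarrow> real^'m \<Rightarrow> real" where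
  "chart_quot B b r y = (y \<bullet> (B *v y) + 2 * (y \<bullet> b) + r) / ((norm y)\<^sup>2 + 1)"

text \<open>The Euclidean gradient by the quotient rule, with numerator over denominator written as
  the value of the quotient itself.\<close>

definition chart_grad :: "real^'m^'m \<Rightarrow> real^'m \<Rightarrow> real \<Rightarrow> real^'m \<Rightarrow> real^'m" where
  "chart_grad B b r y = (2 / ((norm y)\<^sup>2 + 1)) *\<^sub>R (B *v y + b - chart_quot B b r y *\<^sub>R y)"

lemma norm_sq_plus_1_pos: "0 < (norm y)\<^sup>2 + 1"
  by (simp add: add_nonneg_pos)

lemma chart_quot_mult:
  "chart_quot B b r y * ((norm y)\<^sup>2 + 1) = y \<bullet> (B *v y) + 2 * (y \<bullet> b) + r"
  using norm_sq_plus_1_pos[of y] by (simp add: chart_quot_def)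

lemma chart_quot_has_derivative:
  fixes B :: "real^'m^'m"
  assumes "transpose B = B"
  shows "(chart_quot B b r has_derivative (\<lambda>h. chart_grad B b r x \<bullet> h)) (at x)"
proof -
  have nz: "x \<bullet> x + 1 \<noteq> 0"
    using norm_sq_plus_1_pos[of x] by (simp add: power2_norm_eq_inner)
  have B: "((*v) B has_derivative (*v) B) (at x)"
    by (intro bounded_linear_imp_has_derivative matrix_vector_mul_bounded_linear)
  have sym: "x \<bullet> (B *v h) = h \<bullet> (B *v x)" for h
    using symmetric_inner_matrix_vector[OF assms, of x h] by (simp add: inner_commute)
  have N: "((\<lambda>y. y \<bullet> (B *v y) + 2 * (y \<bullet> b) + r) has_derivative (\<lambda>h. 2 * ((B *v x + b) \<bullet> h))) (at x)"
    by (rule has_derivative_eq_rhs, (rule derivative_eq_intros B refl)+)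
      (simp add: fun_eq_iff sym inner_add_left inner_commute[of "B *v x"] inner_commute[of b])
  have D: "((\<lambda>y. y \<bullet> y + 1) has_derivative (\<lambda>h. 2 * (x \<bullet> h))) (at x)"
    by (rule has_derivative_eq_rhs, (rule derivative_eq_intros refl)+)
      (simp add: fun_eq_iff inner_commute)
  have eq: "chart_quot B b r = (\<lambda>y. (y \<bullet> (B *v y) + 2 * (y \<bullet> b) + r) / (y \<bullet> y + 1))"
    by (simp add: fun_eq_iff chart_quot_def power2_norm_eq_inner)
  have "(chart_quot B b r has_derivative
      (\<lambda>h. (2 * ((B *v x + b) \<bullet> h) * (x \<bullet> x + 1)
        - (x \<bullet> (B *v x) + 2 * (x \<bullet> b) + r) * (2 * (x \<bullet> h))) / ((x \<bullet> x + 1) * (x \<bullet> x + 1)))) (at x)"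
    unfolding eq by (rule has_derivative_divide'[OF N D nz])
  moreover have "(2 * (w \<bullet> h) * d - n * (2 * (x \<bullet> h))) / (d * d)
      = ((2 / d) *\<^sub>R (w - (n / d) *\<^sub>R x)) \<bullet> h" if "d \<noteq> 0" for w h d n
    using that by (simp add: inner_diff field_simps)
  ultimately show ?thesis
    using nz by (simp add: chart_grad_def chart_quot_def power2_norm_eq_inner)
qed

text \<open>Keeps of \<open>A\<close>, \<open>M\<close> and \<open>Q\<close> only what the convexity
  argument needs: \<open>p\<close> is the critical point with value \<open>l1\<close>, and
  \<open>B\<close> is bounded below. The 18 is 2 + 16, with 16 a lower bound for
  \<open>chi_P\<close>; it gives \<open>17 * (r - l1) \<le> l2 - r\<close> and
  \<open>16 * (r - l1) \<le> l1 + l2 - 2 * r\<close>.\<close>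

locale rayleigh_chart =
  fixes B :: "real^'m^'m" and b p :: "real^'m" and r l1 l2 :: real
  assumes sym: "transpose B = B"
    and crit: "B *v p + b = l1 *\<^sub>R p"
    and crit_value: "r + b \<bullet> p = l1"
    and coercive: "\<And>h. (l1 + l2 - r) * (h \<bullet> h) \<le> h \<bullet> (B *v h)"
    and l1_le_r: "l1 \<le> r" and l1_less_l2: "l1 < l2" and r_near: "18 * (r - l1) \<le> l2 - l1"
begin

abbreviation "f \<equiv> chart_quot B b r"

section \<open>Minimum, size and convexity of the sublevel set\<close>

lemma b_eq: "b = l1 *\<^sub>R p - B *v p"
  using crit by (simp add: algebra_simps)

lemma inner_B_commute: "x \<bullet> (B *v y) = y \<bullet> (B *v x)"
  using symmetric_inner_matrix_vector[OF sym, of x y] by (simp add: inner_commute)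

text \<open>The left side is a quadratic polynomial in \<open>y\<close>. By \<open>crit\<close> and
  \<open>crit_value\<close> its gradient and its value vanish at \<open>p\<close>, so only its
  second-order part, taken at \<open>y - p\<close>, remains.\<close>

lemma quot_minus_min:
  "(f y - l1) * ((norm y)\<^sup>2 + 1) = (y - p) \<bullet> (B *v (y - p)) - l1 * ((y - p) \<bullet> (y - p))"
proof -
  have "(f y - l1) * ((norm y)\<^sup>2 + 1) = y \<bullet> (B *v y) + 2 * (y \<bullet> b) + r - l1 * (y \<bullet> y + 1)"
    using chart_quot_mult[of B b r y] by (simp add: left_diff_distrib power2_norm_eq_inner)
  moreover have "y \<bullet> b = l1 * (y \<bullet> p) - y \<bullet> (B *v p)"
    by (simp add: b_eq inner_diff)
  moreover have "r = l1 - (l1 * (p \<bullet> p) - p \<bullet> (B *v p))"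
    using crit_value by (simp add: b_eq inner_diff inner_commute)
  moreover have "(y - p) \<bullet> (B *v (y - p)) = y \<bullet> (B *v y) - 2 * (y \<bullet> (B *v p)) + p \<bullet> (B *v p)"
    using inner_B_commute[of p y] by (simp add: matrix_vector_mult_diff_distrib inner_diff)
  moreover have "(y - p) \<bullet> (y - p) = y \<bullet> y - 2 * (y \<bullet> p) + p \<bullet> p"
    by (simp add: inner_diff inner_commute)
  ultimately show ?thesis
    by (simp only:) (simp add: algebra_simps)
qed

lemma coercive_min: "(l2 - r) * (norm (y - p))\<^sup>2 \<le> (f y - l1) * ((norm y)\<^sup>2 + 1)"
  using coercive[of "y - p"] unfolding quot_minus_min
  by (simp add: power2_norm_eq_inner left_diff_distrib distrib_right)

lemma quot_ge: "l1 \<le> f y"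
proof -
  have "0 \<le> (f y - l1) * ((norm y)\<^sup>2 + 1)"
    using coercive_min[of y] r_near l1_less_l2 l1_le_r
    by (smt (verit) mult_nonneg_nonneg zero_le_power2)
  then show ?thesis
    using norm_sq_plus_1_pos[of y] by (simp add: zero_le_mult_iff)
qed

lemma quot_at_p: "f p = l1"
  using quot_minus_min[of p] norm_sq_plus_1_pos[of p] by simp

lemma quot_greater: "y \<noteq> p \<Longrightarrow> l1 < f y"
proof -
  assume "y \<noteq> p"
  then have "0 < (l2 - r) * (norm (y - p))\<^sup>2"
    using r_near l1_less_l2 l1_le_r by simp
  then have "0 < (f y - l1) * ((norm y)\<^sup>2 + 1)"
    using coercive_min[of y] by linarith
  then show ?thesis
    using norm_sq_plus_1_pos[of y] by (simp add: zero_less_mult_iff)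
qed

lemma norm_diff_p_le:
  assumes "f y \<le> r"
  shows "norm (y - p) \<le> (1 + norm y) / 4"
proof -
  have "(l2 - r) * (norm (y - p))\<^sup>2 \<le> (f y - l1) * ((norm y)\<^sup>2 + 1)"
    by (rule coercive_min)
  \<comment> \<open>The available factor 17 is weakened to 16, which has a rational root, and
    \<open>(norm y)\<^sup>2 + 1\<close> to a full square.\<close>
  also have "\<dots> \<le> ((l2 - r) / 16) * (1 + norm y)\<^sup>2"
    using assms r_near l1_less_l2 l1_le_r quot_ge[of y]
    by (intro mult_mono) (auto simp: power2_sum)
  finally have "(l2 - r) * (norm (y - p))\<^sup>2 \<le> (l2 - r) * ((1 + norm y) / 4)\<^sup>2"
    by (simp add: power_divide)
  then have "(norm (y - p))\<^sup>2 \<le> ((1 + norm y) / 4)\<^sup>2"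
    using r_near l1_less_l2 l1_le_r by (subst (asm) mult_le_cancel_left_pos) auto
  then show ?thesis
    by (rule power2_le_imp_le) simp
qed

text \<open>The origin, which represents \<open>q\<close>, has \<open>f 0 = r\<close> and so lies in
  the sublevel set.\<close>

lemma norm_p_le: "norm p \<le> 1 / 4"
  using norm_diff_p_le[of 0] by (simp add: chart_quot_def)

lemma norm_le:
  assumes "f y \<le> r"
  shows "norm y \<le> 2 / 3"
  using norm_diff_p_le[OF assms] norm_p_le norm_triangle_sub[of y p] by argo

lemma sublevel_iff: "f y \<le> r \<longleftrightarrow> y \<bullet> (B *v y) + 2 * (y \<bullet> b) - r * (y \<bullet> y) \<le> 0"
  using norm_sq_plus_1_pos[of y]
  by (simp add: chart_quot_def pos_divide_le_eq power2_norm_eq_inner algebra_simps)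

lemma convex_sublevel: "convex {y. f y \<le> r}"
proof (rule convexI, simp only: mem_Collect_eq sublevel_iff)
  fix x y :: "real^'m" and s t :: real
  let ?g = "\<lambda>y. y \<bullet> (B *v y) + 2 * (y \<bullet> b) - r * (y \<bullet> y)"
  assume x: "?g x \<le> 0" and y: "?g y \<le> 0" and st: "0 \<le> s" "0 \<le> t" "s + t = 1"
  have s: "s = 1 - t"
    using st by simp
  have "0 \<le> (l1 + l2 - 2 * r) * ((x - y) \<bullet> (x - y))"
    using r_near l1_less_l2 l1_le_r by simp
  also have "\<dots> \<le> (x - y) \<bullet> (B *v (x - y)) - r * ((x - y) \<bullet> (x - y))"
    using coercive[of "x - y"] by (simp add: algebra_simps)
  finally have "0 \<le> s * t * ((x - y) \<bullet> (B *v (x - y)) - r * ((x - y) \<bullet> (x - y)))"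
    using st by simp
  \<comment> \<open>For a quadratic polynomial the defect in the chord inequality is exactly
    \<open>s * t\<close> times its second-order part at \<open>x - y\<close>.\<close>
  moreover have "?g (s *\<^sub>R x + t *\<^sub>R y) = s * ?g x + t * ?g y
      - s * t * ((x - y) \<bullet> (B *v (x - y)) - r * ((x - y) \<bullet> (x - y)))"
    unfolding s using inner_B_commute[of y x]
    by (simp add: matrix_vector_mult_diff_distrib matrix_vector_right_distrib
        matrix_vector_mult_scaleR inner_diff inner_add inner_commute algebra_simps)
  moreover have "s * ?g x \<le> 0" "t * ?g y \<le> 0"
    using st x y by (auto intro: mult_nonneg_nonpos)
  ultimately show "?g (s *\<^sub>R x + t *\<^sub>R y) \<le> 0"
    by linarith
qed

section \<open>Tangent inequality and convexity\<close>

lemma grad_inner: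
  "chart_grad B b r x \<bullet> h
    = 2 / ((norm x)\<^sup>2 + 1) * (h \<bullet> ((B - f x *\<^sub>R mat 1) *v (x - p)) - (f x - l1) * (h \<bullet> p))"
proof -
  have "chart_grad B b r x \<bullet> h = 2 / ((norm x)\<^sup>2 + 1) * ((B *v x + b - f x *\<^sub>R x) \<bullet> h)"
    by (simp add: chart_grad_def)
  \<comment> \<open>Expanding around \<open>p\<close> lets \<open>B\<close> enter only through the
    shifted matrix; the remaining term is small because \<open>f x - l1\<close> and \<open>p\<close>
    are.\<close>
  also have "(B *v x + b - f x *\<^sub>R x) \<bullet> h
      = h \<bullet> ((B - f x *\<^sub>R mat 1) *v (x - p)) - (f x - l1) * (h \<bullet> p)"
    by (simp add: b_eq matrix_vector_mult_diff_rdistrib matrix_vector_mult_diff_distrib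
        inner_diff inner_add inner_commute algebra_simps)
  finally show ?thesis .
qed

text \<open>Let \<open>N\<close> be the numerator and \<open>D\<close> the denominator of
  \<open>f\<close>. The quadratic \<open>N - f x * D\<close> vanishes at \<open>x\<close>, has there
  \<open>D x\<close> times the gradient of \<open>f\<close> as its gradient, and has
  \<open>B - f x I\<close> as second-order part. Expand it at \<open>z\<close> and use that
  \<open>D z - D x\<close> is \<open>(x + z) \<bullet> (z - x)\<close>.\<close>

lemma quot_minus_tangent:
  "(f z - f x - chart_grad B b r x \<bullet> (z - x)) * ((norm z)\<^sup>2 + 1)
    = (z - x) \<bullet> ((B - f x *\<^sub>R mat 1) *v (z - x))
      - ((x + z) \<bullet> (z - x)) * (chart_grad B b r x \<bullet> (z - x))"
proof -
  have D: "((norm x)\<^sup>2 + 1) * (chart_grad B b r x \<bullet> (z - x))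
      = 2 * ((B *v x + b - f x *\<^sub>R x) \<bullet> (z - x))"
    using norm_sq_plus_1_pos[of x] by (simp add: chart_grad_def)
  have fx: "f x * (x \<bullet> x + 1) = x \<bullet> (B *v x) + 2 * (x \<bullet> b) + r"
    and fz: "f z * (z \<bullet> z + 1) = z \<bullet> (B *v z) + 2 * (z \<bullet> b) + r"
    using chart_quot_mult[of B b r x] chart_quot_mult[of B b r z]
    by (simp_all add: power2_norm_eq_inner)
  show ?thesis
    using D fx fz inner_B_commute[of z x]
    by (simp add: matrix_vector_mult_diff_rdistrib matrix_vector_mult_diff_distrib power2_norm_eq_inner
      inner_diff inner_add inner_commute algebra_simps)
qed

lemma shifted_coercive:
  assumes "f x \<le> r"
  shows "(l1 + l2 - 2 * r) * (norm h)\<^sup>2 \<le> h \<bullet> ((B - f x *\<^sub>R mat 1) *v h)"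
proof -
  have "f x * (h \<bullet> h) \<le> r * (h \<bullet> h)"
    using assms by (intro mult_right_mono) auto
  then show ?thesis
    using coercive[of h]
    by (simp add: matrix_vector_mult_diff_rdistrib power2_norm_eq_inner inner_diff algebra_simps)
qed

lemma shifted_sym_pos_def:
  assumes "f x \<le> r"
  shows "sym_pos_def (B - f x *\<^sub>R mat 1)"
proof -
  have "0 < h \<bullet> ((B - f x *\<^sub>R mat 1) *v h)" if "h \<noteq> 0" for h
  proof -
    have "0 < (l1 + l2 - 2 * r) * (norm h)\<^sup>2"
      using that r_near l1_less_l2 l1_le_r by simp
    then show ?thesis
      using shifted_coercive[OF assms, of h] by linarith
  qed
  moreover have "transpose (B - f x *\<^sub>R mat 1) = B - f x *\<^sub>R mat 1"
    using sym by (simp add: vec_eq_iff transpose_def mat_def)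
  ultimately show ?thesis
    by (simp add: sym_pos_def_def)
qed

text \<open>By \<open>quot_minus_tangent\<close> it suffices to bound the product of
  \<open>(x + z) \<bullet> h\<close> and the slope along \<open>h\<close> by
  \<open>k\<^sup>2\<close>, the form of \<open>C\<close> at \<open>h\<close>. The first factor is
  controlled by \<open>norm_le\<close>, the second by \<open>grad_inner\<close> and Cauchy-Schwarz
  for \<open>C\<close>.\<close>

lemma tangent_below:
  assumes x: "f x \<le> r" and z: "f z \<le> r"
  shows "f x + chart_grad B b r x \<bullet> (z - x) \<le> f z"
proof -
  define h where "h = z - x"
  define C where "C = B - f x *\<^sub>R mat 1"
  define d where "d = r - l1"
  define D where "D = (norm x)\<^sup>2 + 1"
  define k where "k = sqrt (h \<bullet> (C *v h))"
  have D: "1 \<le> D" and d: "0 \<le> d"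
    using l1_le_r by (simp_all add: D_def d_def)
  have C: "sym_pos_def C"
    unfolding C_def by (rule shifted_sym_pos_def[OF x])
  have H0: "0 \<le> h \<bullet> (C *v h)"
    using sym_pos_def_pos[OF C, of h] by (cases "h = 0") auto
  have k: "k\<^sup>2 = h \<bullet> (C *v h)" "0 \<le> k"
    using H0 by (simp_all add: k_def)
  \<comment> \<open>Here 16 is 18 - 2: \<open>l1 + l2 - 2 * r\<close> is the gap
    \<open>l2 - l1\<close> less \<open>2 * d\<close>.\<close>
  have "16 * d * (norm h)\<^sup>2 \<le> (l1 + l2 - 2 * r) * (norm h)\<^sup>2"
    using r_near by (intro mult_right_mono) (auto simp: d_def)
  also have "\<dots> \<le> k\<^sup>2"
    unfolding k C_def by (rule shifted_coercive[OF x])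
  finally have "(4 * (sqrt d * norm h))\<^sup>2 \<le> k\<^sup>2"
    using d by (simp add: power_mult_distrib)
  then have dh: "sqrt d * norm h \<le> k / 4"
    using power2_le_imp_le[of "4 * (sqrt d * norm h)" k] k by simp
  \<comment> \<open>Since \<open>l1 \<le> f x\<close>, the form of \<open>C\<close> lies below that
    of \<open>B - l1 I\<close>, which \<open>quot_minus_min\<close> evaluates exactly.\<close>
  have "(x - p) \<bullet> (C *v (x - p)) \<le> (f x - l1) * D"
  proof -
    have "l1 * ((x - p) \<bullet> (x - p)) \<le> f x * ((x - p) \<bullet> (x - p))"
      using quot_ge[of x] by (intro mult_right_mono) auto
    then show ?thesis
      by (simp add: D_def quot_minus_min C_def matrix_vector_mult_diff_rdistrib inner_diff)
  qed
  \<comment> \<open>The power of \<open>D\<close> is raised using \<open>1 \<le> D\<close>, so that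
    after taking roots a plain factor \<open>D\<close> cancels the \<open>2 / D\<close> of
    \<open>grad_inner\<close>.\<close>
  also have "\<dots> \<le> d * D\<^sup>2"
    using x D d quot_ge[of x] by (intro mult_mono) (auto simp: d_def power2_eq_square)
  finally have W: "(x - p) \<bullet> (C *v (x - p)) \<le> d * D\<^sup>2" .
  have "(h \<bullet> (C *v (x - p)))\<^sup>2 \<le> k\<^sup>2 * ((x - p) \<bullet> (C *v (x - p)))"
    unfolding k by (rule sym_pos_def_Cauchy_Schwarz[OF C])
  also have "\<dots> \<le> k\<^sup>2 * (d * D\<^sup>2)"
    using W by (intro mult_left_mono) auto
  also have "\<dots> = (k * sqrt d * D)\<^sup>2"
    using d by (simp add: power_mult_distrib)
  finally have a1: "\<bar>h \<bullet> (C *v (x - p))\<bar> \<le> k * sqrt d * D"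
    using k D d by (simp add: abs_le_square_iff[symmetric])
  have "\<bar>(f x - l1) * (h \<bullet> p)\<bar> \<le> d * (norm h * (1 / 4))"
    unfolding abs_mult
    using quot_ge[of x] x norm_p_le Cauchy_Schwarz_ineq2[of h p] d
    by (intro mult_mono order_trans[OF Cauchy_Schwarz_ineq2]) (auto simp: d_def intro: mult_left_mono)
  also have "\<dots> \<le> d * (norm h * (1 / 4)) * D"
    using D d mult_left_mono[of 1 D "d * (norm h * (1 / 4))"] by simp
  finally have a2: "\<bar>(f x - l1) * (h \<bullet> p)\<bar> \<le> d * (norm h * (1 / 4)) * D" .
  have "\<bar>h \<bullet> (C *v (x - p)) - (f x - l1) * (h \<bullet> p)\<bar>
      \<le> k * sqrt d * D + d * (norm h * (1 / 4)) * D"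
    using abs_triangle_ineq4 a1 a2 by (rule order_trans[OF _ add_mono])
  also have "\<dots> = D * (k * sqrt d + d * norm h / 4)"
    by (simp add: algebra_simps)
  finally have "\<bar>h \<bullet> (C *v (x - p)) - (f x - l1) * (h \<bullet> p)\<bar> \<le> \<dots>" .
  then have "2 / D * \<bar>h \<bullet> (C *v (x - p)) - (f x - l1) * (h \<bullet> p)\<bar>
      \<le> 2 / D * (D * (k * sqrt d + d * norm h / 4))"
    using D by (intro mult_left_mono) auto
  then have g: "\<bar>chart_grad B b r x \<bullet> h\<bar> \<le> 2 * (k * sqrt d + d * norm h / 4)"
    using D by (simp only: grad_inner abs_mult C_def D_def[symmetric]) simp
  have xz: "\<bar>(x + z) \<bullet> h\<bar> \<le> 4 / 3 * norm h"
    using norm_le[OF x] norm_le[OF z] norm_triangle_ineq[of x z]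
    by (intro order_trans[OF Cauchy_Schwarz_ineq2] mult_right_mono) auto
  have "((x + z) \<bullet> h) * (chart_grad B b r x \<bullet> h)
      \<le> \<bar>(x + z) \<bullet> h\<bar> * \<bar>chart_grad B b r x \<bullet> h\<bar>"
    by (metis abs_ge_self abs_mult)
  also have "\<dots> \<le> (4 / 3 * norm h) * (2 * (k * sqrt d + d * norm h / 4))"
    using xz g by (intro mult_mono) auto
  \<comment> \<open>Now \<open>norm h\<close> occurs only in \<open>sqrt d * norm h\<close>, which
    \<open>dh\<close> compares with \<open>k\<close>.\<close>
  also have "\<dots> = 8 / 3 * (k * (sqrt d * norm h) + (sqrt d * norm h)\<^sup>2 / 4)"
    using d by (simp add: power_mult_distrib algebra_simps power2_eq_square)
  also have "\<dots> \<le> 8 / 3 * (k * (k / 4) + (k / 4)\<^sup>2 / 4)"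
    using dh k d by (intro mult_left_mono add_mono divide_right_mono power_mono) auto
  \<comment> \<open>The left side equals \<open>17 / 24 * k\<^sup>2\<close>.\<close>
  also have "\<dots> \<le> k\<^sup>2"
    by (simp add: power2_eq_square)
  finally have "0 \<le> (f z - f x - chart_grad B b r x \<bullet> (z - x)) * ((norm z)\<^sup>2 + 1)"
    unfolding quot_minus_tangent k by (simp add: h_def C_def)
  then show ?thesis
    using norm_sq_plus_1_pos[of z] by (simp add: zero_le_mult_iff)
qed

end

lemma convex_on_if_tangent_below:
  fixes f :: "'a::real_inner \<Rightarrow> real"
  assumes "convex S"
    and tangent: "\<And>x z. x \<in> S \<Longrightarrow> z \<in> S \<Longrightarrow> f x + g x \<bullet> (z - x) \<le> f z"
  shows "convex_on S f"
proof (rule convex_onI[OF _ \<open>convex S\<close>])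
  fix t :: real and x y
  assume t: "0 < t" "t < 1" and xy: "x \<in> S" "y \<in> S"
  \<comment> \<open>The tangent at the intermediate point \<open>w\<close> is evaluated at both
    ends; in the weighted mean the linear terms cancel.\<close>
  define w where "w = (1 - t) *\<^sub>R x + t *\<^sub>R y"
  have w: "w \<in> S"
    unfolding w_def using t xy by (intro convexD[OF \<open>convex S\<close>]) auto
  have "(1 - t) * (f w + g w \<bullet> (x - w)) + t * (f w + g w \<bullet> (y - w)) \<le> (1 - t) * f x + t * f y"
    using t w xy tangent by (intro add_mono mult_left_mono) auto
  moreover have "(1 - t) * (f w + g w \<bullet> (x - w)) + t * (f w + g w \<bullet> (y - w))
      = f w + g w \<bullet> ((1 - t) *\<^sub>R (x - w) + t *\<^sub>R (y - w))"
    by (simp add: inner_add algebra_simps)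
  moreover have "(1 - t) *\<^sub>R (x - w) + t *\<^sub>R (y - w) = 0"
    by (simp add: w_def algebra_simps)
  ultimately show "f ((1 - t) *\<^sub>R x + t *\<^sub>R y) \<le> (1 - t) * f x + t * f y"
    by (simp add: w_def)
qed

section \<open>Spectral bound for the pencil\<close>

lemma pencil_eigenvectors_expansion:
  fixes A M :: "real^'n^'n"
  assumes eig: "pencil_eigensystem A M lam u"
  obtains c where "x = (\<Sum>i\<in>{1..CARD('n)}. c i *\<^sub>R u i)"
proof -
  let ?I = "{1..CARD('n)}"
  have uMu: "u j \<bullet> (M *v u i) = (if i = j then 1 else 0)" if "i \<in> ?I" "j \<in> ?I" for i j
    using eig that unfolding pencil_eigensystem_def inner_wrt_def norm_wrt_def
    by (auto simp: real_sqrt_eq_1_iff)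
  have "inj_on u ?I"
    by (rule inj_onI) (metis uMu zero_neq_one)
  have "independent (u ` ?I)"
  proof (rule independent_if_scalars_zero)
    fix a v
    assume sum0: "(\<Sum>v\<in>u ` ?I. a v *\<^sub>R v) = 0" and "v \<in> u ` ?I"
    then obtain j where j: "j \<in> ?I" "v = u j"
      by auto
    \<comment> \<open>Pairing the relation with \<open>M *v u j\<close> isolates the coefficient of
      \<open>u j\<close>.\<close>
    have "0 = (\<Sum>i\<in>?I. a (u i) *\<^sub>R u i) \<bullet> (M *v u j)"
      using sum0 unfolding sum.reindex[OF \<open>inj_on u ?I\<close>] o_def by simp
    also have "\<dots> = (\<Sum>i\<in>?I. if j = i then a (u i) else 0)"
      unfolding inner_sum_left by (rule sum.cong) (use j uMu in auto)
    finally show "a v = 0"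
      using j by simp
  qed simp
  moreover have "card (u ` ?I) = CARD('n)"
    using card_image[OF \<open>inj_on u ?I\<close>] by simp
  ultimately have "UNIV \<subseteq> span (u ` ?I)"
    by (intro card_ge_dim_independent) auto
  then obtain a where "x = (\<Sum>v\<in>u ` ?I. a v *\<^sub>R v)"
    by (auto simp: span_finite)
  then show thesis
    using that[of "\<lambda>i. a (u i)"] unfolding sum.reindex[OF \<open>inj_on u ?I\<close>] o_def by blast
qed

text \<open>Both forms are diagonal in the coordinates \<open>x \<bullet> (M *v u i)\<close>. The
  last term corrects for the component of \<open>x\<close> along \<open>u 1\<close>, so
  \<open>x\<close> may be any vector.\<close>

lemma pencil_eigensystem_form_bound:
  fixes A M :: "real^'n^'n"
  assumes eig: "pencil_eigensystem A M lam u"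
  shows "lam 2 * (x \<bullet> (M *v x)) \<le> x \<bullet> (A *v x) + (lam 2 - lam 1) * (x \<bullet> (M *v u 1))\<^sup>2"
proof -
  let ?I = "{1..CARD('n)}"
  obtain c where x: "x = (\<Sum>i\<in>?I. c i *\<^sub>R u i)"
    using pencil_eigenvectors_expansion[OF eig] .
  have uMu: "u j \<bullet> (M *v u i) = (if i = j then 1 else 0)" if "i \<in> ?I" "j \<in> ?I" for i j
    using eig that unfolding pencil_eigensystem_def inner_wrt_def norm_wrt_def
    by (auto simp: real_sqrt_eq_1_iff)
  have xMu: "x \<bullet> (M *v u i) = c i" if "i \<in> ?I" for i
  proof -
    have "x \<bullet> (M *v u i) = (\<Sum>j\<in>?I. if i = j then c j else 0)"
      unfolding x inner_sum_left by (rule sum.cong) (use that uMu in auto)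
    then show ?thesis
      using that by simp
  qed
  have Au: "A *v u i = lam i *\<^sub>R (M *v u i)" if "i \<in> ?I" for i
    using eig that by (simp add: pencil_eigensystem_def)
  have "x \<bullet> (M *v x) = x \<bullet> (\<Sum>i\<in>?I. c i *\<^sub>R (M *v u i))"
    by (subst (2) x) (simp add: linear_sum[OF matrix_vector_mul_linear] matrix_vector_mult_scaleR)
  also have "\<dots> = (\<Sum>i\<in>?I. (c i)\<^sup>2)"
    unfolding inner_sum_right by (rule sum.cong) (auto simp: xMu power2_eq_square)
  finally have M: "x \<bullet> (M *v x) = (\<Sum>i\<in>?I. (c i)\<^sup>2)" .
  have "x \<bullet> (A *v x) = x \<bullet> (\<Sum>i\<in>?I. c i *\<^sub>R (A *v u i))"
    by (subst (2) x) (simp add: linear_sum[OF matrix_vector_mul_linear] matrix_vector_mult_scaleR)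
  also have "\<dots> = (\<Sum>i\<in>?I. lam i * (c i)\<^sup>2)"
    unfolding inner_sum_right by (rule sum.cong) (auto simp: xMu Au power2_eq_square)
  finally have A: "x \<bullet> (A *v x) = (\<Sum>i\<in>?I. lam i * (c i)\<^sup>2)" .
  have "lam 2 * (x \<bullet> (M *v x)) - x \<bullet> (A *v x) = (\<Sum>i\<in>?I. (lam 2 - lam i) * (c i)\<^sup>2)"
    unfolding A M by (simp add: sum_distrib_left sum_subtractf left_diff_distrib)
  also have "\<dots> \<le> (\<Sum>i\<in>?I. if i = 1 then (lam 2 - lam 1) * (c 1)\<^sup>2 else 0)"
  proof (rule sum_mono)
    fix i assume i: "i \<in> ?I"
    have "lam 2 \<le> lam i" if "i \<noteq> 1"
    proof -
      have "mono_on {2..CARD('n)} lam"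
        using eig by (simp add: pencil_eigensystem_def)
      then show ?thesis
        using i that by (auto intro: mono_onD)
    qed
    then show "(lam 2 - lam i) * (c i)\<^sup>2 \<le> (if i = 1 then (lam 2 - lam 1) * (c 1)\<^sup>2 else 0)"
      by (auto intro: mult_nonpos_nonneg)
  qed
  also have "\<dots> = (lam 2 - lam 1) * (x \<bullet> (M *v u 1))\<^sup>2"
    using xMu[of 1] by (simp add: Suc_leI)
  finally show ?thesis
    by linarith
qed

section \<open>The frame \<open>[q, Q]\<close> and the chart of the hemisphere\<close>

lemma augment_mult_vec:
  "augment q Q *v (\<chi> j. case j of None \<Rightarrow> a | Some k \<Rightarrow> y $ k) = Q *v y + a *\<^sub>R q"
  by (simp add: augment_def matrix_vector_mult_def vec_eq_iff UNIV_option_conv sum.reindex mult.commute)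

text \<open>The frame is an isometry from the Euclidean to the \<open>M\<close>-inner product.
  Coefficients 0 and 1 give the separate relations between \<open>q\<close> and the columns of
  \<open>Q\<close>.\<close>

lemma augment_inner:
  fixes M :: "real^'n^'n" and Q :: "real^'m^'n"
  assumes orth: "transpose (augment q Q) ** M ** augment q Q = mat 1"
  shows "(Q *v y + a *\<^sub>R q) \<bullet> (M *v (Q *v z + c *\<^sub>R q)) = y \<bullet> z + a * c"
proof -
  let ?v = "\<lambda>(a::real) (y::real^'m). (\<chi> j. case j of None \<Rightarrow> a | Some k \<Rightarrow> y $ k) :: real^('m option)"
  have "(augment q Q *v ?v a y) \<bullet> (M *v (augment q Q *v ?v c z))
      = ?v a y \<bullet> ((transpose (augment q Q) ** M ** augment q Q) *v ?v c z)"
    by (simp only: matrix_vector_mul_assoc[symmetric] transpose_inner_matrix_vector)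
  also have "\<dots> = y \<bullet> z + a * c"
    by (simp add: orth inner_vec_def UNIV_option_conv sum.reindex)
  finally show ?thesis
    by (simp only: augment_mult_vec)
qed

lemma augment_decomposition:
  fixes M :: "real^'n^'n" and Q :: "real^'m^'n"
  assumes orth: "transpose (augment q Q) ** M ** augment q Q = mat 1"
    and dim: "CARD('n) = CARD('m) + 1"
  obtains y a where "x = Q *v y + a *\<^sub>R q"
proof -
  have "z = 0" if "augment q Q *v z = 0" for z
  proof -
    have "(transpose (augment q Q) ** M ** augment q Q) *v z = 0"
      by (simp only: matrix_vector_mul_assoc[symmetric] that matrix_vector_mult_0_right)
    then show ?thesis
      by (simp add: orth)
  qed
  then have "inj ((*v) (augment q Q))"
    using linear_injective_0[OF matrix_vector_mul_linear, of "augment q Q"] by blast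
  \<comment> \<open>The index types of rows and columns differ, so surjectivity comes from comparing
    dimensions.\<close>
  then have "dim (range ((*v) (augment q Q))) = CARD('n)"
    using dim by (subst dim_image_eq[OF matrix_vector_mul_linear]) auto
  then have "span (range ((*v) (augment q Q))) = UNIV"
    using dim_eq_full[of "range ((*v) (augment q Q))"] by simp
  then have "range ((*v) (augment q Q)) = UNIV"
    by (simp add: span_eq_iff[THEN iffD2] linear_subspace_image matrix_vector_mul_linear)
  then obtain z where z: "x = augment q Q *v z"
    by (metis surjD)
  have "z = (\<chi> j. case j of None \<Rightarrow> z $ None | Some k \<Rightarrow> (\<chi> k. z $ Some k) $ k)"
    by (simp add: vec_eq_iff split: option.split)
  then have "x = Q *v (\<chi> k. z $ Some k) + z $ None *\<^sub>R q"
    using z augment_mult_vec by metis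
  then show thesis
    by (rule that)
qed

lemma Rq_scaleR: "c \<noteq> 0 \<Longrightarrow> Rq A M (c *\<^sub>R x) = Rq A M x"
  by (simp add: Rq_def matrix_vector_mult_scaleR)

text \<open>\<open>psi\<close> projects the hemisphere centrally onto the affine hyperplane through
  \<open>q\<close> spanned by the columns of \<open>Q\<close>, with inverse \<open>psi_dag\<close>,
  and \<open>Rq\<close> is constant along rays.\<close>

lemma region_Y_eq_sublevel:
  fixes A M :: "real^'n^'n" and Q :: "real^'m^'n"
  assumes orth: "transpose (augment q Q) ** M ** augment q Q = mat 1"
    and dim: "CARD('n) = CARD('m) + 1"
  shows "region_Y A M q Q = {y. phi A M q Q y \<le> Rq A M q}"
proof -
  have qM: "inner_wrt M q (Q *v y + a *\<^sub>R q) = a" for y a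
    using augment_inner[OF orth, of 0 1 y a] by (simp add: inner_wrt_def)
  have QM: "transpose Q *v (M *v (Q *v y + a *\<^sub>R q)) = y" for y a
    using augment_inner[OF orth, of _ 0 y a]
    by (intro vector_eq_ldot[THEN iffD1]) (simp only: transpose_inner_matrix_vector, simp)
  have psi: "psi M q Q (Q *v y + a *\<^sub>R q) = (1 / a) *\<^sub>R y" for y a
    unfolding psi_def qM QM ..
  have norm: "norm_wrt M (Q *v y + q) = sqrt (y \<bullet> y + 1)" for y
    using augment_inner[OF orth, of y 1 y 1] by (simp add: norm_wrt_def inner_wrt_def)
  have "phi A M q Q (psi M q Q x) \<le> Rq A M q" if "x \<in> region_X A M q" for x
  proof -
    obtain y a where x: "x = Q *v y + a *\<^sub>R q"
      using augment_decomposition[OF orth dim] .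
    have "0 < a"
      using that by (simp add: region_X_def hemisphere_def x qM)
    then have "x = a *\<^sub>R (Q *v psi M q Q x + q)"
      by (simp only: x psi) (simp add: matrix_vector_mult_scaleR algebra_simps)
    then have "Rq A M x = phi A M q Q (psi M q Q x)"
      using \<open>0 < a\<close> Rq_scaleR[of a] by (metis less_irrefl phi_def)
    then show ?thesis
      using that by (simp add: region_X_def)
  qed
  moreover have "y \<in> psi M q Q ` region_X A M q" if "phi A M q Q y \<le> Rq A M q" for y
  proof
    define s where "s = 1 / sqrt (y \<bullet> y + 1)"
    have "0 < s"
      by (simp add: s_def add_nonneg_pos)
    have x: "psi_dag M q Q y = s *\<^sub>R (Q *v y + q)"
      by (simp add: psi_dag_def norm s_def)
    then have x': "psi_dag M q Q y = Q *v (s *\<^sub>R y) + s *\<^sub>R q"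
      by (simp add: matrix_vector_mult_scaleR algebra_simps)
    have "norm_wrt M (psi_dag M q Q y) = s * norm_wrt M (Q *v y + q)"
      using \<open>0 < s\<close>
      by (simp add: x norm_wrt_def inner_wrt_def matrix_vector_mult_scaleR real_sqrt_mult
          mult.assoc[symmetric])
    then have "norm_wrt M (psi_dag M q Q y) = 1"
      using \<open>0 < s\<close> by (simp add: norm s_def)
    then show "psi_dag M q Q y \<in> region_X A M q"
      using \<open>0 < s\<close> that Rq_scaleR[of s A M "Q *v y + q"]
      by (simp add: region_X_def hemisphere_def x' qM phi_def x[symmetric])
    show "y = psi M q Q (psi_dag M q Q y)"
      using \<open>0 < s\<close> by (simp only: x' psi) simp
  qed
  ultimately show ?thesis
    by (auto simp: region_Y_def)
qed

section \<open>Lower bound for \<open>chi_P\<close>\<close>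

lemma pencil_eigenvalue_pos:
  assumes "sym_pos_def B" "sym_pos_def P" "pencil_eigenvalue B P \<xi>"
  shows "0 < \<xi>"
proof -
  obtain v where v: "v \<noteq> 0" "B *v v = \<xi> *\<^sub>R (P *v v)"
    using assms(3) by (auto simp: pencil_eigenvalue_def)
  then have "0 < \<xi> * (v \<bullet> (P *v v))" "0 < v \<bullet> (P *v v)"
    using sym_pos_def_pos[OF assms(1), of v] sym_pos_def_pos[OF assms(2), of v] by auto
  then show ?thesis
    by (simp add: zero_less_mult_iff)
qed

text \<open>As \<open>\<xi>max / \<xi>min\<close> is at least 1, it remains to show
  \<open>2 \<le> l2 / l1 * sqrt X\<close>; squared, this is a cubic inequality in \<open>l1\<close>
  and \<open>l2\<close>.\<close>

lemma chi_P_ge_16: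
  assumes l: "0 < l1" "l1 < l2" and \<xi>: "0 < \<xi>min" "\<xi>min \<le> \<xi>max"
  shows "16 \<le> chi_P l1 l2 \<xi>min \<xi>max"
proof -
  define e where "e = l2 - l1"
  have e: "0 < e" "l2 = l1 + e"
    using l by (simp_all add: e_def)
  define X where "X = (l2 + l1) / (2 * (l2 - l1))"
  have "0 < X"
    using l by (simp add: X_def)
  \<comment> \<open>Eight times the difference of the two sides of the next inequality, written in
    \<open>l1\<close> and \<open>e\<close> with the square completed.\<close>
  have "0 \<le> l1 * ((4 * l1 - 3 * e)\<^sup>2 + 23 * e\<^sup>2) + 8 * e ^ 3"
    using l e by (intro add_nonneg_nonneg mult_nonneg_nonneg) auto
  then have "8 * l1\<^sup>2 * (l2 - l1) \<le> l2\<^sup>2 * (l2 + l1)"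
    using l e by (simp add: e(2) power2_eq_square power3_eq_cube algebra_simps)
  then have "2\<^sup>2 \<le> (l2 / l1)\<^sup>2 * X"
    using l by (simp add: X_def field_simps power2_eq_square)
  then have "2\<^sup>2 \<le> (l2 / l1 * sqrt X)\<^sup>2"
    using \<open>0 < X\<close> by (simp only: power_mult_distrib real_sqrt_pow2 less_imp_le)
  then have "2 \<le> l2 / l1 * sqrt X"
    using l \<open>0 < X\<close> by (intro power2_le_imp_le[of 2]) auto
  then have "16 * 1 \<le> (8 * (l2 / l1 * sqrt X)) * (\<xi>max / \<xi>min)"
    using \<xi> by (intro mult_mono) auto
  then show ?thesis
    by (simp add: chi_P_def X_def mult_ac)
qed

section \<open>The Rayleigh quotient in the chart of \<open>[q, Q]\<close>\<close>

theorem theorem2p3: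
  fixes A M :: "real^'n^'n"
    and lam :: "nat \<Rightarrow> real" and u :: "nat \<Rightarrow> real^'n"
    and q :: "real^'n" and Q :: "real^'m^'n"
    and B P :: "real^'m^'m"
    and \<xi>min \<xi>max :: real
  assumes dim: "CARD('n) = CARD('m) + 1"
    and A: "sym_pos_def A" and M: "sym_pos_def M"
    and eig: "pencil_eigensystem A M lam u"
    and q_norm: "norm_wrt M q = 1" and q_u1: "0 < inner_wrt M q (u 1)"
    and orth: "transpose (augment q Q) ** M ** augment q Q = mat 1"
    and B: "B = transpose Q ** A ** Q"
    and P: "sym_pos_def P"
    and \<xi>min: "pencil_eigenvalue B P \<xi>min" "\<And>\<xi>. pencil_eigenvalue B P \<xi> \<Longrightarrow> \<xi>min \<le> \<xi>"
    and \<xi>max: "pencil_eigenvalue B P \<xi>max" "\<And>\<xi>. pencil_eigenvalue B P \<xi> \<Longrightarrow> \<xi> \<le> \<xi>max"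
    and rho_lower: "lam 1 \<le> Rq A M q"
    and rho_upper: "Rq A M q \<le> lam 1 + (lam 2 - lam 1) / (2 + chi_P (lam 1) (lam 2) \<xi>min \<xi>max)"
  shows "convex (region_Y A M q Q)
    \<and> convex_on_wrt P (region_Y A M q Q) (phi A M q Q)
    \<and> (\<exists>!ystar. is_arg_min (phi A M q Q) (\<lambda>y. y \<in> region_Y A M q Q) ystar)
    \<and> (\<forall>ystar. is_arg_min (phi A M q Q) (\<lambda>y. y \<in> region_Y A M q Q) ystar
          \<longrightarrow> u 1 = psi_dag M q Q ystar)"
proof -
  \<comment> \<open>Keeps the index in \<open>u 1\<close> and \<open>lam 1\<close> from turning into
    \<open>Suc 0\<close>.\<close>
  note One_nat_def [simp del]
  define b where "b = transpose Q *v (A *v q)"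
  define r where "r = Rq A M q"
  have uM: "norm_wrt M (u 1) = 1" and Au: "A *v u 1 = lam 1 *\<^sub>R (M *v u 1)"
    and lam: "0 < lam 1" "lam 1 < lam 2"
    using eig dim by (auto simp: pencil_eigensystem_def)
  have trA: "transpose A = A" and trM: "transpose M = M" and trP: "transpose P = P"
    using A M P by (simp_all add: sym_pos_def_def)
  have symA: "x \<bullet> (A *v y) = y \<bullet> (A *v x)" for x y
    using symmetric_inner_matrix_vector[OF trA, of x y] by (simp add: inner_commute)
  have qMq: "q \<bullet> (M *v q) = 1"
    using augment_inner[OF orth, of 0 1 0 1] by simp
  then have r: "r = q \<bullet> (A *v q)"
    by (simp add: r_def Rq_def)
  have Bh: "h \<bullet> (B *v k) = (Q *v h) \<bullet> (A *v (Q *v k))" for h k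
    by (simp only: B matrix_vector_mul_assoc[symmetric] transpose_inner_matrix_vector)
  have hb: "h \<bullet> b = (Q *v h) \<bullet> (A *v q)" for h
    by (simp only: b_def transpose_inner_matrix_vector)
  have trB: "transpose B = B"
    by (simp add: B matrix_transpose_mul trA matrix_mul_assoc)
  have QMQ: "(Q *v h) \<bullet> (M *v (Q *v k)) = h \<bullet> k" for h k
    using augment_inner[OF orth, of h 0 k 0] by simp
  obtain y c where u1: "u 1 = Q *v y + c *\<^sub>R q"
    using augment_decomposition[OF orth dim] .
  have qMu: "q \<bullet> (M *v u 1) = c"
    using augment_inner[OF orth, of 0 1 y c] by (simp add: u1)
  then have "0 < c"
    using q_u1 by (simp add: inner_wrt_def)
  have hMu: "(Q *v h) \<bullet> (M *v u 1) = h \<bullet> y" for h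
    using augment_inner[OF orth, of h 0 y c] by (simp add: u1)
  have yc: "y \<bullet> y + c\<^sup>2 = 1"
    using augment_inner[OF orth, of y c y c] uM
    by (simp add: norm_wrt_def inner_wrt_def u1 power2_eq_square)
  \<comment> \<open>This is \<open>psi M q Q (u 1)\<close>, and \<open>w\<close> below is the
    multiple of \<open>u 1\<close> on the affine hyperplane of the chart.\<close>
  define p where "p = (1 / c) *\<^sub>R y"
  define w where "w = Q *v p + q"
  have QMw: "(Q *v h) \<bullet> (M *v w) = h \<bullet> p" and qMw: "q \<bullet> (M *v w) = 1" for h
    using augment_inner[OF orth, of h 0 p 1] augment_inner[OF orth, of 0 1 p 1]
    by (simp_all add: w_def)
  have u1w: "u 1 = c *\<^sub>R w"
    using \<open>0 < c\<close> by (simp add: u1 w_def p_def matrix_vector_mult_scaleR algebra_simps)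
  then have "c *\<^sub>R (A *v w) = c *\<^sub>R (lam 1 *\<^sub>R (M *v w))"
    using Au by (simp add: matrix_vector_mult_scaleR mult.commute)
  then have Aw: "A *v w = lam 1 *\<^sub>R (M *v w)"
    using \<open>0 < c\<close> by (simp only: scaleR_cancel_left) simp
  have "16 \<le> chi_P (lam 1) (lam 2) \<xi>min \<xi>max"
  proof -
    have "0 < h \<bullet> (B *v h)" if "h \<noteq> 0" for h
    proof -
      have "Q *v h \<noteq> 0"
        using QMQ[of h h] that by auto
      then show ?thesis
        using sym_pos_def_pos[OF A] by (simp add: Bh)
    qed
    then have "0 < \<xi>min"
      using trB pencil_eigenvalue_pos[OF _ P \<xi>min(1)] by (simp add: sym_pos_def_def)
    moreover have "\<xi>min \<le> \<xi>max"
      by (rule \<xi>min(2)[OF \<xi>max(1)])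
    ultimately show ?thesis
      by (rule chi_P_ge_16[OF lam])
  qed
  have "r - lam 1 \<le> (lam 2 - lam 1) / 18"
  proof -
    have "(lam 2 - lam 1) / (2 + chi_P (lam 1) (lam 2) \<xi>min \<xi>max) \<le> (lam 2 - lam 1) / 18"
      using lam \<open>16 \<le> _\<close> by (intro divide_left_mono) auto
    then show ?thesis
      using rho_upper unfolding r_def by linarith
  qed
  interpret rayleigh_chart B b p r "lam 1" "lam 2"
  proof
    show "transpose B = B" "lam 1 < lam 2" "lam 1 \<le> r" "18 * (r - lam 1) \<le> lam 2 - lam 1"
      using trB lam rho_lower \<open>r - lam 1 \<le> _\<close> by (simp_all add: r_def)
    \<comment> \<open>The eigenvector equation \<open>Aw\<close> tested against
      \<open>Q *v h\<close> gives the critical point equation; tested against \<open>q\<close> it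
      gives the critical value.\<close>
    have "h \<bullet> (B *v p + b) = h \<bullet> (lam 1 *\<^sub>R p)" for h
    proof -
      have "h \<bullet> (B *v p + b) = (Q *v h) \<bullet> (A *v w)"
        by (simp add: inner_add_right Bh hb w_def matrix_vector_right_distrib)
      then show ?thesis
        by (simp add: Aw QMw)
    qed
    then show "B *v p + b = lam 1 *\<^sub>R p"
      using vector_eq_ldot by blast
    have "r + b \<bullet> p = q \<bullet> (A *v w)"
      using symA[of q "Q *v p"]
      by (simp add: r inner_commute[of b] hb w_def matrix_vector_right_distrib inner_add_right)
    then show "r + b \<bullet> p = lam 1"
      by (simp add: Aw qMw)
    show "(lam 1 + lam 2 - r) * (h \<bullet> h) \<le> h \<bullet> (B *v h)" for h
    proof -
      \<comment> \<open>The spectral bound is applied to \<open>Q *v h\<close> and to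
        \<open>q\<close>. As \<open>y \<bullet> y = 1 - c\<^sup>2\<close>, the terms in
        \<open>c\<^sup>2\<close> cancel when the two are added.\<close>
      have "lam 2 * (h \<bullet> h) \<le> h \<bullet> (B *v h) + (lam 2 - lam 1) * (h \<bullet> y)\<^sup>2"
        using pencil_eigensystem_form_bound[OF eig, of "Q *v h"] by (simp add: QMQ Bh hMu)
      also have "\<dots> \<le> h \<bullet> (B *v h) + (lam 2 - lam 1) * ((h \<bullet> h) * (1 - c\<^sup>2))"
        using Cauchy_Schwarz_ineq[of h y] yc lam
        by (intro add_left_mono mult_left_mono) (auto simp: eq_diff_eq[symmetric])
      finally have 1: "lam 2 * (h \<bullet> h)
          \<le> h \<bullet> (B *v h) + (lam 2 - lam 1) * ((h \<bullet> h) * (1 - c\<^sup>2))" .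
      have "lam 2 \<le> r + (lam 2 - lam 1) * c\<^sup>2"
        using pencil_eigensystem_form_bound[OF eig, of q] by (simp add: qMq qMu r)
      then have "lam 2 * (h \<bullet> h) \<le> (r + (lam 2 - lam 1) * c\<^sup>2) * (h \<bullet> h)"
        by (rule mult_right_mono) simp
      with 1 show ?thesis
        by (simp add: algebra_simps)
    qed
  qed
  have phi: "phi A M q Q = f"
    using phi_explicit[OF trA trM orth] by (simp add: fun_eq_iff chart_quot_def B b_def r_def)
  have Y: "region_Y A M q Q = {y. f y \<le> r}"
    by (simp add: region_Y_eq_sublevel[OF orth dim] phi r_def)
  have "convex_on_wrt P {y. f y \<le> r} f"
    unfolding convex_on_wrt_def
  proof (intro conjI ballI)
    show "convex_on {y. f y \<le> r} f"
      using convex_sublevel tangent_below by (intro convex_on_if_tangent_below) auto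
    fix x assume x: "x \<in> {y. f y \<le> r}"
    \<comment> \<open>The gradient for \<open>P\<close> is the Euclidean one with \<open>P\<close>
      inverted.\<close>
    obtain g where g: "P *v g = chart_grad B b r x"
      using sym_pos_def_surj[OF P] .
    have "inner_wrt P g h = chart_grad B b r x \<bullet> h" for h
      by (simp add: inner_wrt_def symmetric_inner_matrix_vector[OF trP, symmetric] g)
    then show "\<exists>g. (f has_derivative (\<lambda>h. inner_wrt P g h)) (at x) \<and>
        (\<forall>y\<in>{y. f y \<le> r}. f x + inner_wrt P g (y - x) \<le> f y)"
      using chart_quot_has_derivative[OF trB, of b r x] tangent_below x
      by (intro exI[of _ g]) auto
  qed
  \<comment> \<open>Existence needs no compactness: \<open>p\<close> lies in the set, since
    \<open>f p = lam 1 \<le> r\<close>, and is the strict global minimiser of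
    \<open>f\<close>.\<close>
  moreover have argmin: "is_arg_min f (\<lambda>y. y \<in> {y. f y \<le> r}) z \<longleftrightarrow> z = p" for z
    using quot_greater quot_at_p quot_ge l1_le_r
    by (auto simp: is_arg_min_def not_less) (metis less_le_not_le linear)+
  moreover have "u 1 = psi_dag M q Q p"
  proof -
    \<comment> \<open>Positivity of \<open>c\<close> fixes the sign, so normalising \<open>w\<close>
      gives \<open>u 1\<close> and not its negative.\<close>
    have "c * norm_wrt M w = 1"
      using uM \<open>0 < c\<close>
      by (simp add: u1w norm_wrt_def inner_wrt_def matrix_vector_mult_scaleR real_sqrt_mult
          mult.assoc[symmetric])
    then have "c = 1 / norm_wrt M w"
      by (auto simp: eq_divide_eq)
    then show ?thesis
      unfolding psi_dag_def w_def[symmetric] u1w by simp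
  qed
  ultimately show ?thesis
    using convex_sublevel by (simp add: Y phi)
qed

end
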